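(* (i) For every monotonic GNN $\mathcal{N}$ and all pointed graphs $(G,v)$, $(G',v')$ of its dimension, if there is an injective homomorphism from $(G,v)$ to $(G',v')$ and $\mathcal{N}(G,v)=\mathsf{true}$, then $\mathcal{N}(G',v')=\mathsf{true}$. (ii) There exist a monotonic GNN $\mathcal{N}$ and pointed graphs $(G,v)$, $(G',v')$ such that there is a homomorphism from $(G,v)$ to $(G',v')$, $\mathcal{N}(G,v)=\mathsf{true}$ and $\mathcal{N}(G',v')=\mathsf{false}$.
   Context: Graphs are finite, undirected, simple, node-labelled $G=(V,E,\lambda)$ with $\lambda:V\to\{0,1\}^d$; a pointed graph is $(G,v)$, $v\in V$. A homomorphism from $(G,v)$ to $(G',v')$, $G'=(V',E',\lambda')$, is a map $h:V\to V'$ with $h(v)=v'$ such that $\{u,w\}\in E$ implies $\{h(u),h(w)\}\in E'$ and, for each $i$, if the $i$-th entry of $\lambda(u)$ is $1$ then so is the $i$-th entry of $\lambda'(h(u))$; it is injective if $h$ is. A GNN of dimension $d$ with $L$ layers consists of layers $(\mathsf{agg}_\ell,\mathsf{comb}_\ell)$, where $\mathsf{agg}_\ell$ maps finite multisets of vectors to vectors and $\mathsf{comb}_\ell$ maps vectors to vectors (with compatible dimensions, first input dimension $d$), and a classification function $\mathsf{cls}$ from vectors to $\{\mathsf{false},\mathsf{true}\}$. On $G$: $\lambda^{(0)}=\lambda$, $\lambda^{(\ell)}(v)=\mathsf{comb}_\ell(\lambda^{(\ell-1)}(v),\mathsf{agg}_\ell(\{\!\{\lambda^{(\ell-1)}(w):\{v,w\}\in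 E\}\!\}))$, $\mathcal{N}(G,v)=\mathsf{cls}(\lambda^{(L)}(v))$. Order: vectors componentwise; multisets $M\le M'$ iff there is an injection $f:M\to M'$ with $\mathbf{x}\le f(\mathbf{x})$ for all $\mathbf{x}\in M$; $\mathsf{false}\le\mathsf{true}$. A function is non-decreasing if $x\le y$ implies $f(x)\le f(y)$. A GNN is monotonic if all its aggregation functions, combination functions and its classification function are non-decreasing. *)

theory Defs
  imports "Jordan_Normal_Form.Matrix" "HOL-Library.Multiset"
begin

record 'a lgraph =
  verts :: "'a set"
  edges :: "'a set set"
  label :: "'a \<Rightarrow> real vec"

definition lgraph :: "nat \<Rightarrow> 'a lgraph \<Rightarrow> bool" where
  "lgraph d G \<longleftrightarrow> finite (verts G) \<and>
     (\<forall>e\<in>edges G. e \<subseteq> verts G \<and> card e = 2) \<and>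
     (\<forall>v\<in>verts G. label G v \<in> carrier_vec d \<and> (\<forall>i<d. label G v $ i \<in> {0, 1}))"

definition pointed_lgraph :: "nat \<Rightarrow> 'a lgraph \<Rightarrow> 'a \<Rightarrow> bool" where
  "pointed_lgraph d G v \<longleftrightarrow> lgraph d G \<and> v \<in> verts G"

definition neighbours :: "'a lgraph \<Rightarrow> 'a \<Rightarrow> 'a set" where
  "neighbours G v = {w \<in> verts G. {v, w} \<in> edges G}"

definition homomorphism ::
  "nat \<Rightarrow> 'a lgraph \<Rightarrow> 'a \<Rightarrow> 'b lgraph \<Rightarrow> 'b \<Rightarrow> ('a \<Rightarrow> 'b) \<Rightarrow> bool" where
  "homomorphism d G v G' v' h \<longleftrightarrow> h ` verts G \<subseteq> verts G' \<and> h v = v' \<and>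
     (\<forall>u\<in>verts G. \<forall>w\<in>verts G. {u, w} \<in> edges G \<longrightarrow> {h u, h w} \<in> edges G') \<and>
     (\<forall>u\<in>verts G. \<forall>i<d. label G u $ i = 1 \<longrightarrow> label G' (h u) $ i = 1)"

definition injective_homomorphism ::
  "nat \<Rightarrow> 'a lgraph \<Rightarrow> 'a \<Rightarrow> 'b lgraph \<Rightarrow> 'b \<Rightarrow> ('a \<Rightarrow> 'b) \<Rightarrow> bool" where
  "injective_homomorphism d G v G' v' h \<longleftrightarrow>
     homomorphism d G v G' v' h \<and> inj_on h (verts G)"

text \<open>
  A layer maps vectors of the preceding feature dimension to vectors of dimension
  \<open>out_dim\<close>; the values of \<open>agg\<close> have dimension \<open>agg_dim\<close>. The two arguments of the
  combination function are passed as one concatenated vector.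
\<close>

record layer =
  agg_dim :: nat
  out_dim :: nat
  agg :: "real vec multiset \<Rightarrow> real vec"
  comb :: "real vec \<Rightarrow> real vec"

record gnn =
  gnn_dim :: nat
  layers :: "layer list"
  cls :: "real vec \<Rightarrow> bool"

definition feature_dim :: "gnn \<Rightarrow> nat \<Rightarrow> nat" where
  "feature_dim N l = (gnn_dim N # map out_dim (layers N)) ! l"

definition vec_msets :: "nat \<Rightarrow> real vec multiset set" where
  "vec_msets n = {M. set_mset M \<subseteq> carrier_vec n}"

definition is_gnn :: "gnn \<Rightarrow> bool" where
  "is_gnn N \<longleftrightarrow> (\<forall>l<length (layers N).
     agg (layers N ! l) \<in> vec_msets (feature_dim N l) \<rightarrow> carrier_vec (agg_dim (layers N ! l)) \<and>
     comb (layers N ! l) \<in> carrier_vec (feature_dim N l + agg_dim (layers N ! l))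
       \<rightarrow> carrier_vec (feature_dim N (Suc l)))"

primrec feature :: "gnn \<Rightarrow> 'a lgraph \<Rightarrow> nat \<Rightarrow> 'a \<Rightarrow> real vec" where
  "feature N G 0 v = label G v"
| "feature N G (Suc l) v =
     comb (layers N ! l)
       (feature N G l v @\<^sub>v agg (layers N ! l) (image_mset (feature N G l) (mset_set (neighbours G v))))"

definition gnn_eval :: "gnn \<Rightarrow> 'a lgraph \<Rightarrow> 'a \<Rightarrow> bool" where
  "gnn_eval N G v = cls N (feature N G (length (layers N)) v)"

text \<open>
  An injection between multisets is an injection between their sets of element
  occurrences. This is not the (Dershowitz--Manna) order of the multiset library.
\<close>

definition occurrences :: "'a multiset \<Rightarrow> ('a \<times> nat) set" where
  "occurrences M = {(x, i). i < count M x}"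

definition mset_le :: "'a::ord multiset \<Rightarrow> 'a multiset \<Rightarrow> bool" where
  "mset_le M M' \<longleftrightarrow> (\<exists>f. inj_on f (occurrences M) \<and> f ` occurrences M \<subseteq> occurrences M' \<and>
     (\<forall>p\<in>occurrences M. fst p \<le> fst (f p)))"

definition monotonic_gnn :: "gnn \<Rightarrow> bool" where
  "monotonic_gnn N \<longleftrightarrow> is_gnn N \<and>
     (\<forall>l<length (layers N).
        monotone_on (vec_msets (feature_dim N l)) mset_le (\<le>) (agg (layers N ! l)) \<and>
        monotone_on (carrier_vec (feature_dim N l + agg_dim (layers N ! l))) (\<le>) (\<le>)
          (comb (layers N ! l))) \<and>
     monotone_on (carrier_vec (feature_dim N (length (layers N)))) (\<le>) (\<le>) (cls N)"

end

theory Submission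
  imports Defs
begin

text \<open>
  An injective homomorphism sends distinct neighbours to distinct neighbours, so the multiset of
  features aggregated at a node is dominated by the one aggregated at its image; monotonicity then
  propagates domination of features from layer to layer. Without injectivity, neighbours may be
  identified: a GNN testing for degree at least two accepts the centre of a two-leaf star, but not
  the end of an edge onto which the star can be folded.
\<close>

section \<open>Occurrences and the order on multisets\<close>

lemma occurrences_add_mset:
  "occurrences (add_mset x M) = insert (x, count M x) (occurrences M)"
  by (auto simp: occurrences_def split: if_splits)

lemma finite_occurrences: "finite (occurrences M)"
proof (induction M)
  case empty
  then show ?case by (simp add: occurrences_def)
qed (simp add: occurrences_add_mset)

lemma card_occurrences: "card (occurrences M) = size M"
proof (induction M)
  case empty
  then show ?case by (simp add: occurrences_def)
next
  case (add x M)
  have "(x, count M x) \<notin> occurrences M" by (simp add: occurrences_def)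
  with add show ?case by (simp add: occurrences_add_mset finite_occurrences)
qed

text \<open>An injection between the finite occurrence sets compares their cardinalities, which are
  the sizes. This makes aggregation by size non-decreasing in the counterexample.\<close>

lemma mset_le_imp_size_le: "mset_le M M' \<Longrightarrow> size M \<le> size M'"
  unfolding mset_le_def by (metis card_inj_on_le card_occurrences finite_occurrences)

text \<open>The multiset of values forgets which index produced which occurrence. A bijection
  \<open>e\<close> restores this link, so that maps between index sets can be turned into maps
  between occurrences.\<close>

lemma occurrences_image_mset_enumeration:
  assumes "finite A"
  obtains e where "bij_betw e A (occurrences (image_mset f (mset_set A)))"
    and "\<And>a. a \<in> A \<Longrightarrow> fst (e a) = f a"
proof -
  have "\<exists>e. bij_betw e A (occurrences (image_mset f (mset_set A))) \<and> (\<forall>a\<in>A. fst (e a) = f a)"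
    using assms
  proof (induction A)
    case empty
    then show ?case by (simp add: occurrences_def bij_betw_def)
  next
    case (insert x A)
    let ?M = "image_mset f (mset_set A)"
    obtain e where e: "bij_betw e A (occurrences ?M)" "\<forall>a\<in>A. fst (e a) = f a"
      using insert.IH by blast
    \<comment> \<open>Occurrences of a value are numbered from 0, so the current count of
      \<open>f x\<close> is the first free number for the new index \<open>x\<close>.\<close>
    define e' where "e' = e(x := (f x, count ?M (f x)))"
    have "bij_betw e' A (occurrences ?M)"
      using e(1) insert.hyps(2) by (subst bij_betw_cong[where g = e]) (auto simp: e'_def)
    moreover have "e' x \<notin> occurrences ?M" by (simp add: e'_def occurrences_def)
    ultimately have "bij_betw e' (insert x A) (insert (e' x) (occurrences ?M))"
      using notIn_Un_bij_betw[of x A e' "occurrences ?M"] insert.hyps(2) by simp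
    moreover have "\<forall>a\<in>insert x A. fst (e' a) = f a"
      using e(2) by (simp add: e'_def)
    moreover have "occurrences (image_mset f (mset_set (insert x A))) = insert (e' x) (occurrences ?M)"
      using insert.hyps by (simp add: occurrences_add_mset e'_def)
    ultimately show ?case by metis
  qed
  with that show thesis by blast
qed

text \<open>The required injection is \<open>h\<close> conjugated by enumerations: pass from an
  occurrence to its index in \<open>A\<close>, apply \<open>h\<close>, then take the occurrence
  belonging to that index in \<open>B\<close>.\<close>

lemma mset_le_image_mset_inj:
  assumes "finite B" and "inj_on h A" and "h ` A \<subseteq> B" and "\<And>a. a \<in> A \<Longrightarrow> f a \<le> g (h a)"
  shows "mset_le (image_mset f (mset_set A)) (image_mset g (mset_set B))"
proof -
  let ?P = "occurrences (image_mset f (mset_set A))"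
  let ?Q = "occurrences (image_mset g (mset_set B))"
  have "finite A" using assms(1-3) inj_on_finite by blast
  then obtain e where e: "bij_betw e A ?P" "\<And>a. a \<in> A \<Longrightarrow> fst (e a) = f a"
    using occurrences_image_mset_enumeration by blast
  obtain e' where e': "bij_betw e' B ?Q" "\<And>b. b \<in> B \<Longrightarrow> fst (e' b) = g b"
    using occurrences_image_mset_enumeration[OF assms(1)] by blast
  let ?k = "inv_into A e"
  have k: "bij_betw ?k ?P A" using e(1) by (rule bij_betw_inv_into)
  have kA: "?k p \<in> A" if "p \<in> ?P" for p using k that by (rule bij_betwE[THEN bspec])
  have fst_k: "fst p = f (?k p)" if "p \<in> ?P" for p
    using that kA e bij_betw_inv_into_right by metis
  \<comment> \<open>The three maps are injective on the successive images, hence so is their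
    composition.\<close>
  have "inj_on h (?k ` ?P)" "inj_on e' (h ` ?k ` ?P)"
    using k assms(2,3) e'(1) by (auto simp: bij_betw_def intro: inj_on_subset)
  then have "inj_on (\<lambda>p. e' (h (?k p))) ?P"
    using k by (auto simp: bij_betw_def inj_on_def)
  moreover have "(\<lambda>p. e' (h (?k p))) ` ?P \<subseteq> ?Q"
    using kA assms(3) bij_betwE[OF e'(1)] by blast
  moreover have "fst p \<le> fst (e' (h (?k p)))" if "p \<in> ?P" for p
    using fst_k[OF that] kA[OF that] assms(3,4) e'(2) by auto
  ultimately show ?thesis unfolding mset_le_def by blast
qed

section \<open>Domination of features under injective homomorphisms\<close>

text \<open>Monotonicity of a layer is assumed only on arguments of the right dimension, so features
  must be known to lie in the right carrier before it can be applied.\<close>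

lemma feature_carrier:
  assumes "is_gnn N" and "lgraph (gnn_dim N) G" and "l \<le> length (layers N)" and "v \<in> verts G"
  shows "feature N G l v \<in> carrier_vec (feature_dim N l)"
  using assms(3,4)
proof (induction l arbitrary: v)
  case 0
  then show ?case using assms(2) by (simp add: feature_dim_def lgraph_def)
next
  case (Suc l)
  let ?L = "layers N ! l"
  let ?M = "image_mset (feature N G l) (mset_set (neighbours G v))"
  have l: "l < length (layers N)" using Suc.prems(1) by simp
  have "finite (neighbours G v)" "neighbours G v \<subseteq> verts G"
    using assms(2) by (auto simp: neighbours_def lgraph_def)
  then have "?M \<in> vec_msets (feature_dim N l)"
    using Suc by (auto simp: vec_msets_def)
  then have "agg ?L ?M \<in> carrier_vec (agg_dim ?L)"
    using assms(1) l by (auto simp: is_gnn_def)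
  then have "feature N G l v @\<^sub>v agg ?L ?M \<in> carrier_vec (feature_dim N l + agg_dim ?L)"
    using Suc.IH[of v] Suc.prems by simp
  then show ?case
    using assms(1) l by (auto simp: is_gnn_def)
qed

text \<open>The claim concerns every node \<open>u\<close>, not only the distinguished one, because
  a layer consults the preceding features of all neighbours.\<close>

lemma feature_mono:
  assumes N: "monotonic_gnn N" and G: "lgraph (gnn_dim N) G" and G': "lgraph (gnn_dim N) G'"
    and h: "injective_homomorphism (gnn_dim N) G v G' v' h"
    and "l \<le> length (layers N)" and "u \<in> verts G"
  shows "feature N G l u \<le> feature N G' l (h u)"
  using assms(5,6)
proof (induction l arbitrary: u)
  case 0
  then have "h u \<in> verts G'"
    using h by (auto simp: injective_homomorphism_def homomorphism_def)
  \<comment> \<open>For entries in {0, 1}, preservation of the value 1 is the same as \<le>.\<close>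
  have "label G u $ i \<le> label G' (h u) $ i" if "i < gnn_dim N" for i
  proof -
    have "label G u $ i \<in> {0, 1}" "label G' (h u) $ i \<in> {0, 1}"
      "label G u $ i = 1 \<longrightarrow> label G' (h u) $ i = 1"
      using G G' h 0 that \<open>h u \<in> verts G'\<close>
      by (auto simp: lgraph_def injective_homomorphism_def homomorphism_def)
    then show ?thesis by auto
  qed
  moreover have "label G u \<in> carrier_vec (gnn_dim N)" "label G' (h u) \<in> carrier_vec (gnn_dim N)"
    using G G' 0 \<open>h u \<in> verts G'\<close> by (auto simp: lgraph_def)
  ultimately show ?case by (auto simp: less_eq_vec_def)
next
  case (Suc l)
  let ?L = "layers N ! l" and ?n = "feature_dim N l"
  let ?M = "image_mset (feature N G l) (mset_set (neighbours G u))"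
  let ?M' = "image_mset (feature N G' l) (mset_set (neighbours G' (h u)))"
  have l: "l < length (layers N)" "l \<le> length (layers N)" using Suc.prems by auto
  have gnn: "is_gnn N" using N by (simp add: monotonic_gnn_def)
  have hv: "h w \<in> verts G'" if "w \<in> verts G" for w
    using h that by (auto simp: injective_homomorphism_def homomorphism_def)
  have fin: "finite (neighbours G u)" "finite (neighbours G' (h u))"
    using G G' by (auto simp: neighbours_def lgraph_def)
  \<comment> \<open>Injectivity of \<open>h\<close> enters here: distinct neighbours of
    \<open>u\<close> stay distinct, so none is lost in the aggregation at
    \<open>h u\<close>.\<close>
  have "inj_on h (neighbours G u)"
    using h by (auto simp: injective_homomorphism_def neighbours_def intro: inj_on_subset)
  moreover have "h ` neighbours G u \<subseteq> neighbours G' (h u)"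
    using h Suc.prems(2)
    by (auto simp: injective_homomorphism_def homomorphism_def neighbours_def)
  moreover have "feature N G l w \<le> feature N G' l (h w)" if "w \<in> neighbours G u" for w
    using that Suc.IH l by (simp add: neighbours_def)
  ultimately have "mset_le ?M ?M'" using fin by (intro mset_le_image_mset_inj)
  moreover have M: "?M \<in> vec_msets ?n" "?M' \<in> vec_msets ?n"
    using feature_carrier[OF gnn G l(2)] feature_carrier[OF gnn G' l(2)] fin
    by (auto simp: vec_msets_def neighbours_def)
  ultimately have "agg ?L ?M \<le> agg ?L ?M'"
    using N l by (auto simp: monotonic_gnn_def monotone_on_def)
  moreover have agg: "agg ?L ?M \<in> carrier_vec (agg_dim ?L)" "agg ?L ?M' \<in> carrier_vec (agg_dim ?L)"
    using M gnn l by (auto simp: is_gnn_def)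
  moreover have f: "feature N G l u \<in> carrier_vec ?n" "feature N G' l (h u) \<in> carrier_vec ?n"
    using feature_carrier[OF gnn G l(2)] feature_carrier[OF gnn G' l(2)] Suc.prems(2) hv by auto
  \<comment> \<open>The first blocks share the dimension \<open>?n\<close>, so the order on the
    concatenations can be checked block by block.\<close>
  ultimately have "feature N G l u @\<^sub>v agg ?L ?M \<le> feature N G' l (h u) @\<^sub>v agg ?L ?M'"
    using Suc.IH[OF l(2) Suc.prems(2)] append_vec_le by blast
  moreover have "feature N G l u @\<^sub>v agg ?L ?M \<in> carrier_vec (?n + agg_dim ?L)"
    "feature N G' l (h u) @\<^sub>v agg ?L ?M' \<in> carrier_vec (?n + agg_dim ?L)"
    using agg f by simp_all
  ultimately show ?case
    using N l by (auto simp: monotonic_gnn_def monotone_on_def)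
qed

lemma gnn_eval_injective_homomorphism:
  assumes N: "monotonic_gnn N"
    and G: "pointed_lgraph (gnn_dim N) G v" and G': "pointed_lgraph (gnn_dim N) G' v'"
    and h: "injective_homomorphism (gnn_dim N) G v G' v' h" and "gnn_eval N G v"
  shows "gnn_eval N G' v'"
proof -
  let ?L = "length (layers N)"
  have "h v = v'" using h by (simp add: injective_homomorphism_def homomorphism_def)
  then have "feature N G ?L v \<le> feature N G' ?L v'"
    using feature_mono[OF N _ _ h, of ?L v] G G' by (simp add: pointed_lgraph_def)
  moreover have "feature N G ?L v \<in> carrier_vec (feature_dim N ?L)"
    "feature N G' ?L v' \<in> carrier_vec (feature_dim N ?L)"
    using N G G' by (auto simp: monotonic_gnn_def pointed_lgraph_def intro: feature_carrier)
  ultimately have "cls N (feature N G ?L v) \<le> cls N (feature N G' ?L v')"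
    using N by (auto simp: monotonic_gnn_def monotone_on_def)
  with assms(5) show ?thesis by (simp add: gnn_eval_def)
qed

section \<open>Folding a star: the counterexample\<close>

text \<open>Input labels have dimension 0, so the argument of \<open>comb\<close> consists of the
  aggregated size alone; the identity then outputs the degree of the node.\<close>

definition degree_gnn :: gnn where
  "degree_gnn = \<lparr>gnn_dim = 0,
     layers = [\<lparr>agg_dim = 1, out_dim = 1, agg = \<lambda>M. vec 1 (\<lambda>_. real (size M)), comb = \<lambda>x. x\<rparr>],
     cls = \<lambda>x. 2 \<le> x $ 0\<rparr>"

lemma monotonic_degree_gnn: "monotonic_gnn degree_gnn"
proof -
  have "monotone_on X mset_le (\<le>) (\<lambda>M. vec 1 (\<lambda>_. real (size M)))" for X :: "real vec multiset set"
    by (simp add: monotone_on_def less_eq_vec_def mset_le_imp_size_le)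
  moreover have "monotone_on (carrier_vec 1) (\<le>) (\<le>) (\<lambda>x :: real vec. 2 \<le> x $ 0)"
    by (rule monotone_onI) (fastforce simp: less_eq_vec_def)
  ultimately show ?thesis
    by (simp add: monotonic_gnn_def is_gnn_def degree_gnn_def feature_dim_def monotone_on_def)
qed

text \<open>Since the label is the empty vector, entry 0 of the concatenation is the aggregated size
  and not a label entry.\<close>

lemma gnn_eval_degree_gnn:
  assumes "label G v \<in> carrier_vec 0"
  shows "gnn_eval degree_gnn G v \<longleftrightarrow> 2 \<le> card (neighbours G v)"
  using assms by (simp add: gnn_eval_def degree_gnn_def)

definition star :: "nat \<Rightarrow> nat lgraph" where
  "star n = \<lparr>verts = {..n}, edges = (\<lambda>i. {0, i}) ` {1..n}, label = \<lambda>_. 0\<^sub>v 0\<rparr>"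

lemma edge_star_iff: "{u, w} \<in> edges (star n) \<longleftrightarrow> u = 0 \<and> w \<in> {1..n} \<or> w = 0 \<and> u \<in> {1..n}"
  by (auto simp: star_def doubleton_eq_iff)

lemma pointed_star: "pointed_lgraph 0 (star n) 0"
  by (auto simp: pointed_lgraph_def lgraph_def star_def card_insert_if)

lemma gnn_eval_degree_star: "gnn_eval degree_gnn (star n) 0 \<longleftrightarrow> 2 \<le> n"
proof -
  have "neighbours (star n) 0 = {1..n}"
    unfolding neighbours_def edge_star_iff by (auto simp: star_def)
  then show ?thesis by (simp add: gnn_eval_degree_gnn star_def)
qed

text \<open>The map \<open>min 1\<close> fixes the centre 0 and the leaf 1 and sends the leaf 2 to
  1, merging the two leaves.\<close>

lemma homomorphism_star_fold: "homomorphism 0 (star 2) 0 (star 1) 0 (min 1)"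
  unfolding homomorphism_def edge_star_iff by (auto simp: star_def min_def)

theorem theorem5p3:
  "(\<forall>N (G :: 'a lgraph) v (G' :: 'b lgraph) v'.
      monotonic_gnn N \<longrightarrow>
      pointed_lgraph (gnn_dim N) G v \<longrightarrow> pointed_lgraph (gnn_dim N) G' v' \<longrightarrow>
      (\<exists>h. injective_homomorphism (gnn_dim N) G v G' v' h) \<longrightarrow>
      gnn_eval N G v \<longrightarrow> gnn_eval N G' v')
   \<and>
   (\<exists>N (G :: nat lgraph) v (G' :: nat lgraph) v'.
      monotonic_gnn N \<and>
      pointed_lgraph (gnn_dim N) G v \<and> pointed_lgraph (gnn_dim N) G' v' \<and>
      (\<exists>h. homomorphism (gnn_dim N) G v G' v' h) \<and>
      gnn_eval N G v \<and> \<not> gnn_eval N G' v')"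
proof (rule conjI)
  have "gnn_dim degree_gnn = 0" by (simp add: degree_gnn_def)
  then have "monotonic_gnn degree_gnn \<and>
      pointed_lgraph (gnn_dim degree_gnn) (star 2) 0 \<and>
      pointed_lgraph (gnn_dim degree_gnn) (star 1) 0 \<and>
      (\<exists>h. homomorphism (gnn_dim degree_gnn) (star 2) 0 (star 1) 0 h) \<and>
      gnn_eval degree_gnn (star 2) 0 \<and> \<not> gnn_eval degree_gnn (star 1) 0"
    using monotonic_degree_gnn pointed_star homomorphism_star_fold
    by (auto simp: gnn_eval_degree_star)
  then show "\<exists>N (G :: nat lgraph) v (G' :: nat lgraph) v'.
      monotonic_gnn N \<and>
      pointed_lgraph (gnn_dim N) G v \<and> pointed_lgraph (gnn_dim N) G' v' \<and>
      (\<exists>h. homomorphism (gnn_dim N) G v G' v' h) \<and>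
      gnn_eval N G v \<and> \<not> gnn_eval N G' v'"
    by blast
\<comment> \<open>The conjunct still open is preservation under injective homomorphisms.\<close>
qed (intro allI impI, elim exE, rule gnn_eval_injective_homomorphism, assumption+)

end
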